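(* For any integers $k>m_1>m_2>0$, $$F_{[k,m_1,m_2]}(x)=\frac{U_{\alpha+\beta}(z)U_{\alpha+\gamma-1}(z)U_{\beta+\gamma}(z)+U_{\beta-1}(z)U_\beta(z)}{\sqrt{x}\,U_{\alpha+\beta}(z)U_{\alpha+\gamma}(z)U_{\beta+\gamma}(z)},$$ where $\alpha=k-m_1$, $\beta=m_1-m_2$, $\gamma=m_2$, and $z=1/(2\sqrt{x})$.
   Context: A permutation $\alpha\in S_n$ contains a pattern $\tau\in S_k$ if there are indices $1\le i_1<\dots<i_k\le n$ with $(\alpha_{i_1},\dots,\alpha_{i_k})$ order-isomorphic to $\tau$; otherwise it avoids $\tau$. For a pattern $\tau$, $f_\tau(n)$ is the number of permutations in $S_n$ avoiding both $132$ and $\tau$ ($S_0$ consists of the empty permutation), and $F_\tau(x)=\sum_{n\ge0}f_\tau(n)x^n$. For $k>m_1>m_2>0$, $[k,m_1,m_2]$ denotes the permutation $(m_1+1,\dots,k,\ m_2+1,\dots,m_1,\ 1,\dots,m_2)\in S_k$. $U_p$ is the Chebyshev polynomial of the second kind, $U_p(\cos\theta)=\sin((p+1)\theta)/\sin\theta$, with $U_{-1}=0$. *)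

theory Defs
  imports
    "HOL-Analysis.Analysis"
    "HOL-Combinatorics.Combinatorics"
    "HOL-Computational_Algebra.Computational_Algebra"
begin

(* Permutations of {1..n} are written in one-line notation, as lists without repetition;
   list positions start at 0. *)

definition contains_pattern :: "nat list \<Rightarrow> nat list \<Rightarrow> bool" where
  "contains_pattern \<sigma> \<tau> \<longleftrightarrow>
     (\<exists>i. strict_mono_on {..<length \<tau>} i \<and> i ` {..<length \<tau>} \<subseteq> {..<length \<sigma>} \<and>
          (\<forall>a<length \<tau>. \<forall>b<length \<tau>. \<sigma> ! i a < \<sigma> ! i b \<longleftrightarrow> \<tau> ! a < \<tau> ! b))"

abbreviation avoids_pattern :: "nat list \<Rightarrow> nat list \<Rightarrow> bool" where
  "avoids_pattern \<sigma> \<tau> \<equiv> \<not> contains_pattern \<sigma> \<tau>"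

definition avoid_count :: "nat list \<Rightarrow> nat \<Rightarrow> nat" where
  "avoid_count \<tau> n =
     card {\<sigma> \<in> permutations_of_set {1..n}. avoids_pattern \<sigma> [1, 3, 2] \<and> avoids_pattern \<sigma> \<tau>}"

definition avoid_gf :: "nat list \<Rightarrow> real fps" where
  "avoid_gf \<tau> = Abs_fps (\<lambda>n. of_nat (avoid_count \<tau> n))"

definition three_block_pattern :: "nat \<Rightarrow> nat \<Rightarrow> nat \<Rightarrow> nat list" where
  "three_block_pattern k m\<^sub>1 m\<^sub>2 = [m\<^sub>1 + 1..<k + 1] @ [m\<^sub>2 + 1..<m\<^sub>1 + 1] @ [1..<m\<^sub>2 + 1]"

(* The index is an integer, so that index subtraction is not truncated; the convention
   U_{-1} = 0 is the case p = -1 of the defining equation. Existence and uniqueness of the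
   polynomial are proved below. *)
definition chebyshev_U :: "int \<Rightarrow> real poly" where
  "chebyshev_U p =
     (THE q. \<forall>\<theta>. sin \<theta> \<noteq> 0 \<longrightarrow> poly q (cos \<theta>) = sin (of_int (p + 1) * \<theta>) / sin \<theta>)"

lemma chebyshev_U_unique:
  fixes q r :: "real poly"
  assumes "\<And>\<theta>. sin \<theta> \<noteq> 0 \<Longrightarrow> poly q (cos \<theta>) = poly r (cos \<theta>)"
  shows "q = r"
proof -
  have "{-1<..<1} \<subseteq> {y. poly (q - r) y = 0}"
  proof
    fix y :: real assume y: "y \<in> {-1<..<1}"
    then have "arccos y > 0" "arccos y < pi" using arccos_lt_bounded[of y] by auto
    then have "sin (arccos y) \<noteq> 0" using sin_gt_zero by force
    then show "y \<in> {y. poly (q - r) y = 0}" using assms[of "arccos y"] y by simp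
  qed
  moreover have "infinite {-1<..<(1::real)}" by (simp add: infinite_Ioo)
  ultimately have "infinite {y. poly (q - r) y = 0}" using finite_subset by blast
  then have "q - r = 0" using poly_roots_finite by blast
  then show ?thesis by simp
qed

lemma chebyshev_U_exists:
  "\<exists>q. \<forall>\<theta>::real. sin \<theta> \<noteq> 0 \<longrightarrow> poly q (cos \<theta>) = sin (of_int (p + 1) * \<theta>) / sin \<theta>"
proof -
  have step: "sin (of_nat (Suc (Suc n)) * \<theta>) = 2 * cos \<theta> * sin (of_nat (Suc n) * \<theta>) - sin (of_nat n * \<theta>)"
    for n and \<theta> :: real
  proof -
    define u where "u = of_nat (Suc n) * \<theta>"
    have "of_nat (Suc (Suc n)) * \<theta> = u + \<theta>" "of_nat n * \<theta> = u - \<theta>"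
      by (simp_all add: u_def algebra_simps)
    then show ?thesis unfolding u_def[symmetric] by (simp add: sin_add sin_diff)
  qed
  have nat: "\<exists>q. \<forall>\<theta>::real. sin \<theta> \<noteq> 0 \<longrightarrow> poly q (cos \<theta>) = sin (of_nat n * \<theta>) / sin \<theta>" for n
  proof (induction n rule: induct_nat_012)
    case 0
    show ?case by (rule exI[of _ 0]) simp
  next
    case 1
    show ?case by (rule exI[of _ 1]) simp
  next
    case (ge2 n)
    then obtain q r where
      "\<forall>\<theta>::real. sin \<theta> \<noteq> 0 \<longrightarrow> poly q (cos \<theta>) = sin (of_nat n * \<theta>) / sin \<theta>"
      "\<forall>\<theta>::real. sin \<theta> \<noteq> 0 \<longrightarrow> poly r (cos \<theta>) = sin (of_nat (Suc n) * \<theta>) / sin \<theta>"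
      by blast
    then show ?case
      by (intro exI[of _ "[:0, 2:] * r - q"]) (simp add: step diff_divide_distrib del: of_nat_Suc)
  qed
  show ?thesis
  proof (cases "p + 1 \<ge> 0")
    case True
    then show ?thesis using nat[of "nat (p + 1)"] by simp
  next
    case False
    obtain q where
      "\<forall>\<theta>::real. sin \<theta> \<noteq> 0 \<longrightarrow> poly q (cos \<theta>) = sin (of_nat (nat (- (p + 1))) * \<theta>) / sin \<theta>"
      using nat by blast
    moreover have "(of_nat (nat (- (p + 1))) :: real) * \<theta> = - (of_int (p + 1) * \<theta>)" for \<theta>
      using False by (simp add: algebra_simps)
    ultimately show ?thesis by (intro exI[of _ "- q"]) simp
  qed
qed

lemma chebyshev_U_cos:
  assumes "sin \<theta> \<noteq> 0"
  shows "poly (chebyshev_U p) (cos \<theta>) = sin (of_int (p + 1) * \<theta>) / sin \<theta>"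
proof -
  have "\<exists>!q. \<forall>\<theta>::real. sin \<theta> \<noteq> 0 \<longrightarrow> poly q (cos \<theta>) = sin (of_int (p + 1) * \<theta>) / sin \<theta>"
    using chebyshev_U_exists[of p] by (intro ex_ex1I) (auto intro!: chebyshev_U_unique)
  from theI'[OF this] assms show ?thesis unfolding chebyshev_U_def by blast
qed

lemma chebyshev_U_minus_one: "chebyshev_U (-1) = 0"
  by (rule chebyshev_U_unique) (simp add: chebyshev_U_cos)

(* U_p evaluated at a formal Laurent series. *)
definition chebyshev_U_fls :: "int \<Rightarrow> real fls \<Rightarrow> real fls" where
  "chebyshev_U_fls p z = poly (map_poly fls_const (chebyshev_U p)) z"

end

(* A non-empty 132-avoiding permutation is l n r, where l and r avoid 132 and every entry of l
   exceeds every entry of r. An occurrence of [k, m1, m2] consists of three increasing blocks A, B, C,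
   each below the preceding one, so that it is split by the maximum n between two blocks: a prefix of
   the blocks lies in l n, the rest in r, and only a single block A can use the entry n (which leaves
   the shortened block A' in l). Distinguishing whether l avoids A', only AB, or only ABC gives
     F_ABC = 1 + x (F_A' F_ABC + (F_AB - F_A') F_BC + (F_ABC - F_AB) F_C),
   with analogous equations for F_AB and F_A. The latter are solved by
   F_A = U_(a-1) / (t U_a) and F_AB = U_(a+b-1) / (t U_(a+b)), where x = t^2 and a, b are the block
   lengths; the first one then follows from Vajda's identity for the Chebyshev polynomials. *)

theory Submission
  imports Defs "HOL-Library.Sublist"
begin

section \<open>Occurrences of decreasing sequences of increasing blocks\<close>

definition order_iso :: "nat list \<Rightarrow> nat list \<Rightarrow> bool" where
  "order_iso w \<tau> \<longleftrightarrow> length w = length \<tau> \<and>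
     (\<forall>a<length \<tau>. \<forall>b<length \<tau>. w ! a < w ! b \<longleftrightarrow> \<tau> ! a < \<tau> ! b)"

lemma subseq_set:
  assumes "subseq xs ys"
  shows "set xs \<subseteq> set ys"
  using list_emb_set[OF assms] by blast

lemma subseq_map_nth:
  assumes "sorted_wrt (<) is" "\<forall>i\<in>set is. i < length xs"
  shows "subseq (map ((!) xs) is) xs"
proof -
  have "subseq is [0..<length xs]"
    using assms by (intro sorted_subset_imp_subseq) auto
  from subseq_map[OF this, of "(!) xs"] show ?thesis by (simp add: map_nth)
qed

lemma subseq_imp_index:
  assumes "subseq w xs"
  shows "\<exists>i. strict_mono_on {..<length w} i \<and> i ` {..<length w} \<subseteq> {..<length xs} \<and>
             (\<forall>a<length w. w ! a = xs ! i a)"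
  using assms
proof (induction rule: list_emb.induct)
  case (list_emb_Nil ys)
  then show ?case by auto
next
  case (list_emb_Cons xs ys y)
  then obtain i where "strict_mono_on {..<length xs} i" "i ` {..<length xs} \<subseteq> {..<length ys}"
    "\<forall>a<length xs. xs ! a = ys ! i a" by blast
  then show ?case
    by (intro exI[of _ "\<lambda>a. Suc (i a)"]) (auto simp: strict_mono_on_def)
next
  case (list_emb_Cons2 x y xs ys)
  then obtain i where i: "strict_mono_on {..<length xs} i" "i ` {..<length xs} \<subseteq> {..<length ys}"
    "\<forall>a<length xs. xs ! a = ys ! i a" by blast
  \<comment> \<open>The matched heads send position 0 to position 0; the embedding of the tails is
    shifted by one on both sides.\<close>
  define j where "j a = (case a of 0 \<Rightarrow> 0 | Suc b \<Rightarrow> Suc (i b))" for a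
  have "strict_mono_on {..<length (x # xs)} j"
    using i(1) by (auto simp: strict_mono_on_def j_def split: nat.split)
  moreover have "j ` {..<length (x # xs)} \<subseteq> {..<length (y # ys)}"
    using i(2) by (auto simp: j_def image_subset_iff split: nat.split)
  moreover have "\<forall>a<length (x # xs). (x # xs) ! a = (y # ys) ! j a"
    using i(3) list_emb_Cons2(1) by (auto simp: j_def split: nat.split)
  ultimately show ?case by blast
qed

text \<open>Subsequences replace index maps because a subsequence of \<open>l @ r\<close> splits
  into one of \<open>l\<close> and one of \<open>r\<close>; this is how an occurrence is later cut
  at the maximum.\<close>

lemma contains_pattern_iff_subseq:
  "contains_pattern \<sigma> \<tau> \<longleftrightarrow> (\<exists>w. subseq w \<sigma> \<and> order_iso w \<tau>)"
proof
  assume "contains_pattern \<sigma> \<tau>"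
  then obtain i where i: "strict_mono_on {..<length \<tau>} i" "i ` {..<length \<tau>} \<subseteq> {..<length \<sigma>}"
    "\<forall>a<length \<tau>. \<forall>b<length \<tau>. \<sigma> ! i a < \<sigma> ! i b \<longleftrightarrow> \<tau> ! a < \<tau> ! b"
    unfolding contains_pattern_def by blast
  let ?is = "map i [0..<length \<tau>]"
  have "sorted_wrt (<) ?is"
    using i(1) by (auto simp: sorted_wrt_iff_nth_less strict_mono_on_def)
  then have "subseq (map ((!) \<sigma>) ?is) \<sigma>"
    using i(2) by (intro subseq_map_nth) (auto simp: image_subset_iff)
  moreover have "order_iso (map ((!) \<sigma>) ?is) \<tau>"
    using i(3) by (auto simp: order_iso_def)
  ultimately show "\<exists>w. subseq w \<sigma> \<and> order_iso w \<tau>" by blast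
next
  assume "\<exists>w. subseq w \<sigma> \<and> order_iso w \<tau>"
  then obtain w where "subseq w \<sigma>" and w: "order_iso w \<tau>" by blast
  from subseq_imp_index[OF this(1)] obtain i where "strict_mono_on {..<length w} i"
    "i ` {..<length w} \<subseteq> {..<length \<sigma>}" "\<forall>a<length w. w ! a = \<sigma> ! i a"
    by blast
  with w show "contains_pattern \<sigma> \<tau>"
    unfolding contains_pattern_def order_iso_def by auto
qed

lemma order_iso_append:
  assumes "length u = length u'"
  shows "order_iso (u @ v) (u' @ v') \<longleftrightarrow> order_iso u u' \<and> order_iso v v' \<and>
    (\<forall>a<length u'. \<forall>b<length v'. (u ! a < v ! b \<longleftrightarrow> u' ! a < v' ! b) \<and> (v ! b < u ! a \<longleftrightarrow> v' ! b < u' ! a))"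
    (is "?L \<longleftrightarrow> ?R")
proof
  assume L: ?L
  then have len: "length v = length v'" using assms by (simp add: order_iso_def)
  have *: "(u @ v) ! a < (u @ v) ! b \<longleftrightarrow> (u' @ v') ! a < (u' @ v') ! b"
    if "a < length u' + length v'" "b < length u' + length v'" for a b
    using L that by (simp add: order_iso_def)
  have "order_iso u u'"
    unfolding order_iso_def
  proof (intro conjI allI impI assms)
    fix a b assume "a < length u'" "b < length u'"
    then show "u ! a < u ! b \<longleftrightarrow> u' ! a < u' ! b"
      using *[of a b] assms by (simp add: nth_append)
  qed
  moreover have "order_iso v v'"
    unfolding order_iso_def
  proof (intro conjI allI impI len)
    fix a b assume "a < length v'" "b < length v'"
    then show "v ! a < v ! b \<longleftrightarrow> v' ! a < v' ! b"
      using *[of "length u' + a" "length u' + b"] assms by (simp add: nth_append)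
  qed
  moreover have "(u ! a < v ! b \<longleftrightarrow> u' ! a < v' ! b) \<and> (v ! b < u ! a \<longleftrightarrow> v' ! b < u' ! a)"
    if "a < length u'" "b < length v'" for a b
    using that assms *[of a "length u' + b"] *[of "length u' + b" a] by (simp add: nth_append)
  ultimately show ?R by blast
next
  assume R: ?R
  have len: "length v = length v'" using R by (simp add: order_iso_def)
  show ?L
    unfolding order_iso_def
  proof (intro conjI allI impI)
    show "length (u @ v) = length (u' @ v')" using assms len by simp
    fix a b assume ab: "a < length (u' @ v')" "b < length (u' @ v')"
    show "(u @ v) ! a < (u @ v) ! b \<longleftrightarrow> (u' @ v') ! a < (u' @ v') ! b"
      using R ab assms
      by (cases "a < length u'"; cases "b < length u'") (simp_all add: nth_append order_iso_def)
  qed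
qed

section \<open>Patterns that are descending sequences of increasing blocks\<close>

fun skew_blocks :: "nat list \<Rightarrow> nat list \<Rightarrow> bool" where
  "skew_blocks [] w \<longleftrightarrow> w = []"
| "skew_blocks (b # bs) w \<longleftrightarrow> (\<exists>u v. w = u @ v \<and> length u = b \<and> sorted_wrt (<) u \<and>
     (\<forall>x\<in>set u. \<forall>y\<in>set v. y < x) \<and> skew_blocks bs v)"

lemma skew_blocks_ConsI:
  assumes "length u = b" "sorted_wrt (<) u" "\<forall>x\<in>set u. \<forall>y\<in>set v. y < x" "skew_blocks bs v"
  shows "skew_blocks (b # bs) (u @ v)"
  using assms by auto

lemma order_iso_sorted_wrt:
  assumes "order_iso u u'" "sorted_wrt (<) u'"
  shows "sorted_wrt (<) u"
  using assms by (auto simp: order_iso_def sorted_wrt_iff_nth_less)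

lemma sorted_wrt_order_iso:
  assumes "length u = length u'" "sorted_wrt (<) u" "sorted_wrt (<) u'"
  shows "order_iso u u'"
  unfolding order_iso_def
proof (intro conjI allI impI assms(1))
  fix a b assume ab: "a < length u'" "b < length u'"
  have *: "w ! a < w ! b \<longleftrightarrow> a < b" if "sorted_wrt (<) w" "length w = length u'" for w :: "nat list"
    using ab that sorted_wrt_nth_less[of "(<)" w a b] sorted_wrt_nth_less[of "(<)" w b a]
    by (cases a b rule: linorder_cases) simp_all
  show "u ! a < u ! b \<longleftrightarrow> u' ! a < u' ! b"
    using *[of u] *[of u'] assms by simp
qed

text \<open>The block lengths alone fix every comparison: entries grow inside a block and drop from
  a block to any later one.\<close>

lemma skew_blocks_order_iso:
  assumes "skew_blocks bs w" "skew_blocks bs \<tau>"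
  shows "order_iso w \<tau>"
  using assms
proof (induction bs arbitrary: w \<tau>)
  case Nil
  then show ?case by (simp add: order_iso_def)
next
  case (Cons b bs)
  then obtain u v u' v' where uv: "w = u @ v" "length u = b" "sorted_wrt (<) u"
      "\<forall>x\<in>set u. \<forall>y\<in>set v. y < x" "skew_blocks bs v"
    and uv': "\<tau> = u' @ v'" "length u' = b" "sorted_wrt (<) u'"
      "\<forall>x\<in>set u'. \<forall>y\<in>set v'. y < x" "skew_blocks bs v'"
    by auto
  have iso: "order_iso v v'" "order_iso u u'"
    using uv uv' Cons.IH by (auto intro: sorted_wrt_order_iso)
  then have "v ! j < u ! i" "v' ! j < u' ! i" if "i < length u'" "j < length v'" for i j
    using that uv uv' by (auto simp: order_iso_def)
  then have "(u ! i < v ! j \<longleftrightarrow> u' ! i < v' ! j) \<and> (v ! j < u ! i \<longleftrightarrow> v' ! j < u' ! i)"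
    if "i < length u'" "j < length v'" for i j
    using that by (simp add: less_imp_le leD)
  with iso show ?case by (simp add: uv(1,2) uv'(1,2) order_iso_append)
qed

text \<open>Being increasing and lying below are statements about comparisons, so \<open>w\<close>
  inherits them from the pattern when its first block is cut off at the same length.\<close>

lemma order_iso_skew_blocks:
  assumes "order_iso w \<tau>" "skew_blocks bs \<tau>"
  shows "skew_blocks bs w"
  using assms
proof (induction bs arbitrary: w \<tau>)
  case Nil
  then show ?case by (simp add: order_iso_def)
next
  case (Cons b bs)
  then obtain u' v' where uv': "\<tau> = u' @ v'" "length u' = b" "sorted_wrt (<) u'"
      "\<forall>x\<in>set u'. \<forall>y\<in>set v'. y < x" "skew_blocks bs v'"
    by auto
  define u v where "u = take b w" and "v = drop b w"
  have w: "w = u @ v" "length u = length u'"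
    using Cons.prems(1) uv' by (auto simp: u_def v_def order_iso_def)
  from Cons.prems(1) have iso: "order_iso u u'" "order_iso v v'"
    and cross: "\<forall>i<length u'. \<forall>j<length v'. v ! j < u ! i \<longleftrightarrow> v' ! j < u' ! i"
    using w by (auto simp: uv'(1) order_iso_append)
  have "\<forall>x\<in>set u. \<forall>y\<in>set v. y < x"
    using cross iso uv'(4) by (simp add: all_set_conv_all_nth order_iso_def)
  moreover have "sorted_wrt (<) u" using iso uv' order_iso_sorted_wrt by blast
  moreover have "skew_blocks bs v" using Cons.IH iso uv' by blast
  ultimately show ?case using w uv'(2) skew_blocks_ConsI by simp
qed

definition has_blocks :: "nat list \<Rightarrow> nat list \<Rightarrow> bool" where
  "has_blocks \<sigma> bs \<longleftrightarrow> (\<exists>w. subseq w \<sigma> \<and> skew_blocks bs w)"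

text \<open>The pattern and its occurrences satisfy the same predicate, so its entries can be
  forgotten and only the list of block lengths is kept.\<close>

lemma contains_pattern_iff_has_blocks:
  assumes "skew_blocks bs \<tau>"
  shows "contains_pattern \<sigma> \<tau> \<longleftrightarrow> has_blocks \<sigma> bs"
  using assms skew_blocks_order_iso order_iso_skew_blocks
  unfolding contains_pattern_iff_subseq has_blocks_def by blast

lemma skew_blocks_three_block_pattern:
  assumes "k > m\<^sub>1" "m\<^sub>1 > m\<^sub>2"
  shows "skew_blocks [k - m\<^sub>1, m\<^sub>1 - m\<^sub>2, m\<^sub>2] (three_block_pattern k m\<^sub>1 m\<^sub>2)"
proof -
  have "skew_blocks [m\<^sub>2] [1..<m\<^sub>2 + 1]"
    by (simp del: upt_Suc)
  then have "skew_blocks [m\<^sub>1 - m\<^sub>2, m\<^sub>2] ([m\<^sub>2 + 1..<m\<^sub>1 + 1] @ [1..<m\<^sub>2 + 1])"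
    by (subst skew_blocks.simps, intro exI[of _ "[m\<^sub>2 + 1..<m\<^sub>1 + 1]"] exI[of _ "[1..<m\<^sub>2 + 1]"])
       (auto simp del: upt_Suc skew_blocks.simps)
  then show ?thesis
    unfolding three_block_pattern_def using assms
    by (subst skew_blocks.simps, intro exI[of _ "[m\<^sub>1 + 1..<k + 1]"]
          exI[of _ "[m\<^sub>2 + 1..<m\<^sub>1 + 1] @ [1..<m\<^sub>2 + 1]"])
       (auto simp del: upt_Suc skew_blocks.simps)
qed

section \<open>Cutting block occurrences along a concatenation\<close>

lemma skew_blocks_append:
  assumes "skew_blocks bs v" "skew_blocks cs w" "\<forall>x\<in>set v. \<forall>y\<in>set w. y < x"
  shows "skew_blocks (bs @ cs) (v @ w)"
  using assms
proof (induction bs arbitrary: v)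
  case Nil
  then show ?case by simp
next
  case (Cons b bs)
  then obtain u v' where "v = u @ v'" "length u = b" "sorted_wrt (<) u"
    "\<forall>x\<in>set u. \<forall>y\<in>set v'. y < x" "skew_blocks bs v'" by auto
  with Cons have "skew_blocks (b # bs @ cs) (u @ v' @ w)"
    by (intro skew_blocks_ConsI) auto
  with \<open>v = u @ v'\<close> show ?case by simp
qed

text \<open>An increasing block cannot hold an entry of \<open>v\<close> followed by a smaller entry
  of \<open>w\<close>, so the border between \<open>v\<close> and \<open>w\<close> falls between two
  blocks.\<close>

lemma skew_blocks_split:
  assumes "skew_blocks bs (v @ w)" "\<forall>x\<in>set v. \<forall>y\<in>set w. y < x"
  shows "\<exists>cs ds. bs = cs @ ds \<and> skew_blocks cs v \<and> skew_blocks ds w"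
  using assms
proof (induction bs arbitrary: v)
  case Nil
  then show ?case by auto
next
  case (Cons b bs)
  then obtain u s where us: "v @ w = u @ s" "length u = b" "sorted_wrt (<) u"
    "\<forall>x\<in>set u. \<forall>y\<in>set s. y < x" "skew_blocks bs s" by auto
  from us(1) consider z where "v = u @ z" "s = z @ w" | z where "u = v @ z" "w = z @ s" "z \<noteq> []"
    by (cases "\<exists>z. v = u @ z") (auto simp: append_eq_append_conv2)
  then show ?case
  proof cases
    case 1
    then have "skew_blocks bs (z @ w)" "\<forall>x\<in>set z. \<forall>y\<in>set w. y < x"
      using us(5) Cons.prems(2) by auto
    from Cons.IH[OF this] obtain cs ds where "bs = cs @ ds" "skew_blocks cs z" "skew_blocks ds w"
      by blast
    moreover from this have "skew_blocks (b # cs) v"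
      using 1 us unfolding \<open>v = u @ z\<close> by (intro skew_blocks_ConsI) auto
    ultimately show ?thesis by (metis append_Cons)
  next
    case 2
    \<comment> \<open>An entry of \<open>v\<close> would precede an entry of \<open>z\<close> in the
      increasing word \<open>u\<close>, but \<open>z\<close> is part of \<open>w\<close> and lies
      below \<open>v\<close>. Hence all blocks go to \<open>w\<close>.\<close>
    have "v = []"
      using Cons.prems(2) us(3) 2 by (cases v; cases z) force+
    then show ?thesis using Cons.prems by (intro exI[of _ "[]"] exI[of _ "b # bs"]) auto
  qed
qed

text \<open>The two pieces of an occurrence can be chosen independently, since every entry of
  \<open>l\<close> lies above every entry of \<open>r\<close>.\<close>

lemma has_blocks_append:
  assumes "\<forall>x\<in>set l. \<forall>y\<in>set r. y < x"
  shows "has_blocks (l @ r) bs \<longleftrightarrow> (\<exists>cs ds. bs = cs @ ds \<and> has_blocks l cs \<and> has_blocks r ds)"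
proof
  assume "has_blocks (l @ r) bs"
  then obtain x where x: "subseq x (l @ r)" "skew_blocks bs x"
    unfolding has_blocks_def by blast
  from x(1) obtain v w where vw: "x = v @ w" "subseq v l" "subseq w r"
    by (rule subseq_appendE)
  have "\<forall>x\<in>set v. \<forall>y\<in>set w. y < x"
    using assms subseq_set[OF vw(2)] subseq_set[OF vw(3)] by blast
  with x(2) obtain cs ds where "bs = cs @ ds" "skew_blocks cs v" "skew_blocks ds w"
    using skew_blocks_split unfolding vw(1) by blast
  with vw show "\<exists>cs ds. bs = cs @ ds \<and> has_blocks l cs \<and> has_blocks r ds"
    unfolding has_blocks_def by blast
next
  assume "\<exists>cs ds. bs = cs @ ds \<and> has_blocks l cs \<and> has_blocks r ds"
  then obtain cs ds v w where bs: "bs = cs @ ds" and v: "subseq v l" "skew_blocks cs v"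
    and w: "subseq w r" "skew_blocks ds w"
    unfolding has_blocks_def by blast
  have "\<forall>x\<in>set v. \<forall>y\<in>set w. y < x"
    using assms subseq_set[OF v(1)] subseq_set[OF w(1)] by blast
  with v(2) w(2) have "skew_blocks bs (v @ w)" unfolding bs by (rule skew_blocks_append)
  moreover have "subseq (v @ w) (l @ r)" using v(1) w(1) by (rule list_emb_append_mono)
  ultimately show "has_blocks (l @ r) bs"
    unfolding has_blocks_def by blast
qed

text \<open>Keeping only the leading or only the trailing blocks of an occurrence is possible at
  will; this yields the inclusions between classes of avoiders.\<close>

lemma has_blocks_append_sub:
  assumes "has_blocks \<sigma> (bs @ cs)"
  shows "has_blocks \<sigma> bs" "has_blocks \<sigma> cs"
proof -
  have *: "\<exists>v v'. w = v @ v' \<and> skew_blocks bs v \<and> skew_blocks cs v'" if "skew_blocks (bs @ cs) w" for w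
    using that
  proof (induction bs arbitrary: w)
    case Nil
    then show ?case by auto
  next
    case (Cons b bs)
    from Cons.prems obtain u s where us: "w = u @ s" "length u = b" "sorted_wrt (<) u"
      "\<forall>x\<in>set u. \<forall>y\<in>set s. y < x" "skew_blocks (bs @ cs) s" by auto
    with Cons.IH obtain v v' where "s = v @ v'" "skew_blocks bs v" "skew_blocks cs v'" by blast
    moreover from this us have "skew_blocks (b # bs) (u @ v)"
      by (intro skew_blocks_ConsI) auto
    ultimately show ?case using us(1) by (metis append_assoc)
  qed
  from assms obtain w where "subseq w \<sigma>" "skew_blocks (bs @ cs) w"
    unfolding has_blocks_def by blast
  with * obtain v v' where v: "subseq (v @ v') \<sigma>" "skew_blocks bs v" "skew_blocks cs v'"
    by blast
  have "subseq v (v @ v')" "subseq v' (v @ v')" by auto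
  with v show "has_blocks \<sigma> bs" "has_blocks \<sigma> cs"
    unfolding has_blocks_def by (blast intro: subseq_order.order_trans)+
qed

lemma has_blocks_Nil [simp]: "has_blocks \<sigma> []"
  by (auto simp: has_blocks_def)

lemma has_blocks_single: "has_blocks \<sigma> [b] \<longleftrightarrow> (\<exists>w. subseq w \<sigma> \<and> length w = b \<and> sorted_wrt (<) w)"
  by (auto simp: has_blocks_def)

lemma has_blocks_single_mono:
  assumes "has_blocks \<sigma> [b]" "c \<le> b"
  shows "has_blocks \<sigma> [c]"
proof -
  from assms(1) obtain w where w: "subseq w \<sigma>" "length w = b" "sorted_wrt (<) w"
    by (auto simp: has_blocks_single)
  have "subseq (take c w) \<sigma>"
    using w(1) take_is_prefix prefix_imp_subseq subseq_order.order_trans by blast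
  then show ?thesis
    using w assms(2) by (auto simp: has_blocks_single sorted_wrt_take intro!: exI[of _ "take c w"])
qed

section \<open>Block occurrences under a shift and under appending a maximum\<close>

lemma has_blocks_map_add: "has_blocks (map (\<lambda>x. x + c) \<sigma>) bs \<longleftrightarrow> has_blocks \<sigma> bs"
proof -
  have "order_iso (map (\<lambda>x. x + c) w) w" "order_iso w (map (\<lambda>x. x + c) w)" for w
    by (simp_all add: order_iso_def)
  then have *: "skew_blocks bs (map (\<lambda>x. x + c) w) \<longleftrightarrow> skew_blocks bs w" for w
    using order_iso_skew_blocks by blast
  have "subseq w (map (\<lambda>x. x + c) \<sigma>) \<longleftrightarrow> (\<exists>v. w = map (\<lambda>x. x + c) v \<and> subseq v \<sigma>)" for w
  proof
    assume "subseq w (map (\<lambda>x. x + c) \<sigma>)"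
    then obtain N where "w = nths (map (\<lambda>x. x + c) \<sigma>) N" using subseq_conv_nths by blast
    then have "w = map (\<lambda>x. x + c) (nths \<sigma> N)" by (simp add: nths_map)
    then show "\<exists>v. w = map (\<lambda>x. x + c) v \<and> subseq v \<sigma>" using subseq_conv_nths by blast
  qed (auto intro: subseq_map)
  then show ?thesis unfolding has_blocks_def by (metis *)
qed

text \<open>A final maximum prolongs every increasing run of \<open>l\<close> by one entry, and
  deleting it costs a run at most one entry.\<close>

lemma has_blocks_snoc_single:
  assumes "\<forall>x\<in>set l. x < m" "b > 0"
  shows "has_blocks (l @ [m]) [b] \<longleftrightarrow> has_blocks l [b - 1]"
proof
  assume "has_blocks (l @ [m]) [b]"
  then obtain x where x: "subseq x (l @ [m])" "length x = b" "sorted_wrt (<) x"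
    unfolding has_blocks_single by blast
  from x(1) obtain v w where "x = v @ w" "subseq v l" "subseq w [m]"
    by (rule subseq_appendE)
  with x have vw: "subseq v l" "subseq w [m]" "length (v @ w) = b" "sorted_wrt (<) (v @ w)"
    by simp_all
  have "length w \<le> 1" using list_emb_length[OF vw(2)] by simp
  then have "b - 1 \<le> length v" using vw(3) by simp
  moreover have "has_blocks l [length v]"
    using vw by (auto simp: has_blocks_single sorted_wrt_append)
  ultimately show "has_blocks l [b - 1]" using has_blocks_single_mono by blast
next
  assume "has_blocks l [b - 1]"
  then obtain w where w: "subseq w l" "length w = b - 1" "sorted_wrt (<) w"
    by (auto simp: has_blocks_single)
  have "\<forall>x\<in>set w. x < m" using w(1) assms(1) by (meson subseq_set subsetD)
  with w assms(2) have "subseq (w @ [m]) (l @ [m])" "length (w @ [m]) = b" "sorted_wrt (<) (w @ [m])"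
    by (auto simp: sorted_wrt_append)
  then show "has_blocks (l @ [m]) [b]" unfolding has_blocks_single by blast
qed

text \<open>With a second nonempty block, an occurrence ends below its first block and therefore
  cannot end in the maximum.\<close>

lemma has_blocks_snoc_multiple:
  assumes "\<forall>x\<in>set l. x < m" "b > 0" "c > 0"
  shows "has_blocks (l @ [m]) (b # c # bs) \<longleftrightarrow> has_blocks l (b # c # bs)"
proof
  assume "has_blocks (l @ [m]) (b # c # bs)"
  then obtain x where x: "subseq x (l @ [m])" "skew_blocks (b # c # bs) x"
    unfolding has_blocks_def by blast
  from x(1) obtain v w where "x = v @ w" "subseq v l" "subseq w [m]"
    by (rule subseq_appendE)
  with x have vw: "subseq v l" "subseq w [m]" "skew_blocks (b # c # bs) (v @ w)"
    by simp_all
  have "w = []"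
  proof (rule ccontr)
    assume "w \<noteq> []"
    moreover have "length w \<le> 1" using list_emb_length[OF vw(2)] by simp
    ultimately obtain y where "w = [y]" by (cases w) auto
    with vw(2) have w: "w = [m]" by (simp split: if_splits)
    from vw(3) obtain u s where us: "v @ w = u @ s" "length u = b" "skew_blocks (c # bs) s"
      "\<forall>x\<in>set u. \<forall>y\<in>set s. y < x" by auto
    have "s \<noteq> []" using us(3) assms(3) by auto
    then obtain s' where s: "s = s' @ [m]" "v = u @ s'"
      using us(1) w by (cases s rule: rev_cases) auto
    \<comment> \<open>This entry of the first block comes from \<open>l\<close> and so lies below
      \<open>m\<close>, whereas the block order puts it above \<open>m\<close>.\<close>
    obtain x where "x \<in> set u" using us(2) assms(2) by (cases u) auto
    with s us(4) have "m < x" by auto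
    moreover have "x < m"
      using \<open>x \<in> set u\<close> s(2) vw(1) assms(1) by (metis Un_iff set_append subseq_set subsetD)
    ultimately show False by simp
  qed
  with vw(1,3) show "has_blocks l (b # c # bs)"
    unfolding has_blocks_def by (metis append_Nil2)
next
  assume "has_blocks l (b # c # bs)"
  then show "has_blocks (l @ [m]) (b # c # bs)"
    unfolding has_blocks_def by (blast intro: subseq_rev_drop_many)
qed

section \<open>Decomposition at the maximum\<close>

lemma contains_132_iff:
  "contains_pattern \<sigma> [1, 3, 2] \<longleftrightarrow> (\<exists>a b c. subseq [a, b, c] \<sigma> \<and> a < c \<and> c < b)"
proof -
  have *: "order_iso w [1, 3, 2] \<longleftrightarrow> (\<exists>a b c. w = [a, b, c] \<and> a < c \<and> c < b)" for w
  proof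
    assume w: "order_iso w [1, 3, 2]"
    then have "length w = Suc (Suc (Suc 0))" by (simp add: order_iso_def)
    then obtain a b c where abc: "w = [a, b, c]" by (auto simp: length_Suc_conv)
    have "[a, b, c] ! i < [a, b, c] ! j \<longleftrightarrow> [1, 3, 2::nat] ! i < [1, 3, 2] ! j" if "i < 3" "j < 3" for i j
      using w that by (simp add: order_iso_def abc)
    from this[of 0 2] this[of 2 1] show "\<exists>a b c. w = [a, b, c] \<and> a < c \<and> c < b"
      by (simp add: abc)
  next
    assume "\<exists>a b c. w = [a, b, c] \<and> a < c \<and> c < b"
    then obtain a b c where abc: "w = [a, b, c]" "a < c" "c < b" by blast
    then have "a < b" "\<not> c < a" "\<not> b < c" "\<not> b < a" by simp_all
    with abc show "order_iso w [1, 3, 2]"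
      by (simp add: order_iso_def All_less_Suc)
  qed
  show ?thesis unfolding contains_pattern_iff_subseq * by blast
qed

text \<open>If the smallest entry of an occurrence lies in \<open>l\<close>, then so does its last
  entry, which is larger and is not the maximum; hence the whole occurrence is in \<open>l\<close>.
  Otherwise it lies in \<open>m # r\<close> and cannot begin with \<open>m\<close>.\<close>

lemma contains_132_max:
  assumes "\<forall>x\<in>set l. x < m" "\<forall>x\<in>set r. x < m" "\<forall>x\<in>set l. \<forall>y\<in>set r. y < x"
  shows "contains_pattern (l @ m # r) [1, 3, 2] \<longleftrightarrow>
           contains_pattern l [1, 3, 2] \<or> contains_pattern r [1, 3, 2]"
proof
  assume "contains_pattern (l @ m # r) [1, 3, 2]"
  then obtain a b c where abc: "subseq [a, b, c] (l @ m # r)" "a < c" "c < b"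
    unfolding contains_132_iff by blast
  from abc(1) obtain p s where ps: "[a, b, c] = p @ s" "subseq p l" "subseq s (m # r)"
    by (rule subseq_appendE)
  have sets: "set p \<subseteq> set l" "set s \<subseteq> set (m # r)"
    using ps(2,3) subseq_set by blast+
  from ps(1) consider "p = []" "s = [a, b, c]" | "p = [a]" "s = [b, c]"
    | "p = [a, b]" "s = [c]" | "p = [a, b, c]" "s = []"
    unfolding Cons_eq_append_conv by auto
  then show "contains_pattern l [1, 3, 2] \<or> contains_pattern r [1, 3, 2]"
  proof cases
    case 1
    \<comment> \<open>As \<open>m\<close> stands first in \<open>m # r\<close>, it could only play
      the smallest entry of the pattern.\<close>
    have "a \<noteq> m" using 1 sets assms(2) abc(2,3) by fastforce
    then have "subseq [a, b, c] r" using ps(3) 1 by simp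
    with abc show ?thesis unfolding contains_132_iff by blast
  next
    case 2
    then have "c \<in> set r" using sets assms(2) abc(3) by fastforce
    then show ?thesis using 2 sets assms(3) abc(2) by fastforce
  next
    case 3
    then have "c \<in> set r" using sets assms(1) abc(3) by fastforce
    then show ?thesis using 3 sets assms(3) abc(2) by fastforce
  next
    case 4
    with ps(2) abc show ?thesis unfolding contains_132_iff by blast
  qed
next
  assume "contains_pattern l [1, 3, 2] \<or> contains_pattern r [1, 3, 2]"
  moreover have "subseq w (l @ m # r)" if "subseq w l \<or> subseq w r" for w
    using that by (auto intro: subseq_rev_drop_many subseq_drop_many)
  ultimately show "contains_pattern (l @ m # r) [1, 3, 2]"
    unfolding contains_132_iff by blast
qed

section \<open>Nonempty 132-avoiders as pairs of smaller 132-avoiders\<close>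

lemma contains_pattern_map_add:
  "contains_pattern (map (\<lambda>x. x + c) \<sigma>) \<tau> \<longleftrightarrow> contains_pattern \<sigma> \<tau>"
proof -
  have "(map (\<lambda>x. x + c) \<sigma> ! i a < map (\<lambda>x. x + c) \<sigma> ! i b) = (\<sigma> ! i a < \<sigma> ! i b)"
    if "i ` {..<length \<tau>} \<subseteq> {..<length \<sigma>}" "a < length \<tau>" "b < length \<tau>" for i a b
    using that by (simp add: image_subset_iff)
  then show ?thesis
    unfolding contains_pattern_def by (intro iff_exI) (auto simp: image_subset_iff)
qed

text \<open>All sizes are collected in one set, with the length recording the size, so that
  generating functions can be attached to arbitrary subsets.\<close>

definition perms132 :: "nat list set" where
  "perms132 = {\<sigma> \<in> permutations_of_set {1..length \<sigma>}. avoids_pattern \<sigma> [1, 3, 2]}"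

lemma perms132_iff:
  "\<sigma> \<in> perms132 \<longleftrightarrow> set \<sigma> = {1..length \<sigma>} \<and> distinct \<sigma> \<and> avoids_pattern \<sigma> [1, 3, 2]"
  by (auto simp: perms132_def permutations_of_set_def)

text \<open>This inverts the cut at the maximum: the shift places the values of \<open>l\<close>
  directly above those of \<open>r\<close>.\<close>

definition glue :: "nat list \<Rightarrow> nat list \<Rightarrow> nat list" where
  "glue l r = map (\<lambda>x. x + length r) l @ Suc (length l + length r) # r"

lemma length_glue [simp]: "length (glue l r) = Suc (length l + length r)"
  by (simp add: glue_def)

lemma Nil_neq_glue [simp]: "[] \<noteq> glue l r"
  by (simp add: glue_def)

lemma glue_orders:
  assumes "l \<in> perms132" "r \<in> perms132"
  shows "\<forall>x\<in>set (map (\<lambda>x. x + length r) l). x < Suc (length l + length r)"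
    and "\<forall>x\<in>set r. x < Suc (length l + length r)"
    and "\<forall>x\<in>set (map (\<lambda>x. x + length r) l). \<forall>y\<in>set r. y < x"
  using assms by (auto simp: perms132_iff)

lemma glue_in_perms132:
  assumes "l \<in> perms132" "r \<in> perms132"
  shows "glue l r \<in> perms132"
proof -
  have l: "set l = {1..length l}" and r: "set r = {1..length r}"
    using assms by (simp_all add: perms132_iff)
  have "set (map (\<lambda>x. x + length r) l) = {1 + length r..length l + length r}"
    by (simp add: l image_add_atLeastAtMost')
  then have "set (glue l r) = {1..length (glue l r)}"
    by (auto simp: glue_def r)
  moreover have "distinct (glue l r)"
    using assms glue_orders[OF assms]
    by (fastforce simp: glue_def perms132_iff distinct_map inj_on_def)
  moreover have "avoids_pattern (glue l r) [1, 3, 2]"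
    using assms unfolding glue_def contains_132_max[OF glue_orders[OF assms]]
    by (simp add: contains_pattern_map_add perms132_iff)
  ultimately show ?thesis by (simp add: perms132_iff)
qed

text \<open>Equal lengths give equal maxima, and the maximum occurs only once, so its position
  determines both factors.\<close>

lemma glue_inject:
  assumes "glue l r = glue l' r'" "l \<in> perms132" "r \<in> perms132" "l' \<in> perms132" "r' \<in> perms132"
  shows "l = l'" "r = r'"
proof -
  let ?m = "Suc (length l + length r)"
  have m: "Suc (length l' + length r') = ?m"
    using arg_cong[OF assms(1), of length] by simp
  have notin: "?m \<notin> set (map (\<lambda>x. x + length r) l)" "?m \<notin> set r"
    using glue_orders[OF assms(2,3)] by blast+
  have "map (\<lambda>x. x + length r) l = map (\<lambda>x. x + length r') l' \<and> r = r'"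
    using assms(1) unfolding glue_def m append_Cons_eq_iff[OF notin] .
  then show "r = r'" "l = l'"
    by (auto dest!: map_injective simp: inj_def)
qed

lemma inj_on_glue: "inj_on (case_prod glue) (perms132 \<times> perms132)"
proof (rule inj_onI, clarify)
  fix l r l' r'
  assume "l \<in> perms132" "r \<in> perms132" "l' \<in> perms132" "r' \<in> perms132" "glue l r = glue l' r'"
  then show "l = l' \<and> r = r'" using glue_inject[of l r l' r'] by blast
qed

text \<open>In a permutation avoiding 132, every entry before the maximum exceeds every entry after it.\<close>

lemma perms132_eq_glue:
  assumes "\<sigma> \<in> perms132" "\<sigma> \<noteq> []"
  obtains l r where "l \<in> perms132" "r \<in> perms132" "\<sigma> = glue l r"
proof -
  define n where "n = length \<sigma>"
  have set_\<sigma>: "set \<sigma> = {1..n}" and dist: "distinct \<sigma>" and av: "avoids_pattern \<sigma> [1, 3, 2]"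
    using assms(1) by (auto simp: perms132_iff n_def)
  have "n \<in> set \<sigma>" using assms(2) by (auto simp: set_\<sigma> n_def Suc_le_eq)
  then obtain L r where \<sigma>: "\<sigma> = L @ n # r" by (meson split_list)
  have n: "n = Suc (length L + length r)" using arg_cong[OF \<sigma>, of length] n_def by simp
  have "n \<notin> set L \<union> set r" using dist unfolding \<sigma> by simp
  moreover have "insert n (set L \<union> set r) = {1..n}" using set_\<sigma> unfolding \<sigma> by simp
  ultimately have "set L \<union> set r = {1..n} - {n}" by blast
  also have "\<dots> = {1..<n}" by auto
  finally have un: "set L \<union> set r = {1..<n}" .
  \<comment> \<open>Otherwise \<open>x\<close>, \<open>n\<close>, \<open>y\<close> would be an
    occurrence of 132.\<close>
  have lt: "y < x" if "x \<in> set L" "y \<in> set r" for x y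
  proof -
    have "subseq [x] L" "subseq [y] r" using that unfolding subseq_singleton_left by blast+
    then have "subseq ([x] @ [n, y]) (L @ n # r)"
      by (rule list_emb_append_mono[OF _ subseq_Cons2])
    then have "subseq [x, n, y] \<sigma>" unfolding \<sigma> by simp
    then have "\<not> (x < y \<and> y < n)" using av unfolding contains_132_iff by blast
    moreover have "y < n" using that un by auto
    moreover have "x \<noteq> y" using that dist unfolding \<sigma> by auto
    ultimately show ?thesis by simp
  qed
  \<comment> \<open>A value below an entry of \<open>r\<close> cannot lie in \<open>L\<close>, so
    the values of \<open>r\<close> form an initial segment.\<close>
  have down: "z \<in> set r" if "y \<in> set r" "1 \<le> z" "z \<le> y" for y z
  proof -
    have "y < n" using that(1) un by auto
    then have "z \<in> set L \<union> set r" using that(2,3) unfolding un by simp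
    then show ?thesis using lt[of z y] that by auto
  qed
  have set_r: "set r = {1..length r}"
  proof (cases "r = []")
    case False
    \<comment> \<open>The initial segment reaches up to its maximum, and counting identifies that
      maximum with \<open>length r\<close>.\<close>
    define M where "M = Max (set r)"
    have M: "M \<in> set r" "\<forall>y\<in>set r. y \<le> M" using False by (simp_all add: M_def)
    have "set r = {1..M}"
    proof (intro equalityI subsetI)
      fix z assume "z \<in> set r"
      moreover from this have "1 \<le> z" using un by auto
      ultimately show "z \<in> {1..M}" using M(2) by simp
    next
      fix z assume "z \<in> {1..M}"
      then show "z \<in> set r" using down[OF M(1), of z] by simp
    qed
    moreover have "card (set r) = length r" using dist unfolding \<sigma> by (simp add: distinct_card)
    ultimately show ?thesis by simp
  qed simp
  have "set L \<inter> set r = {}" using dist unfolding \<sigma> by auto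
  then have "set L = (set L \<union> set r) - set r" by blast
  also have "\<dots> = {1..<Suc (length L + length r)} - {1..length r}"
    unfolding un by (simp only: n set_r)
  also have "\<dots> = {length r + 1..length L + length r}" by auto
  finally have set_L: "set L = {length r + 1..length L + length r}" .
  \<comment> \<open>The truncated subtraction loses nothing, because every entry of \<open>L\<close>
    exceeds \<open>length r\<close>.\<close>
  define l where "l = map (\<lambda>x. x - length r) L"
  have L: "map (\<lambda>x. x + length r) l = L"
    unfolding l_def map_map by (rule map_idI) (simp add: set_L)
  have "set l = {1..length l}"
  proof -
    have "(\<lambda>x. x + length r) ` set l = set L"
      using arg_cong[OF L, of set] by simp
    also have "\<dots> = (\<lambda>x. x + length r) ` {1..length l}"
      unfolding set_L by (simp add: l_def image_add_atLeastAtMost' add.commute)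
    finally have "(\<lambda>x. x + length r) ` set l = (\<lambda>x. x + length r) ` {1..length l}" .
    then show ?thesis by (subst (asm) inj_image_eq_iff) (simp_all add: inj_def)
  qed
  moreover have "distinct l"
    using dist distinct_map[of "\<lambda>x. x + length r" l] unfolding L \<sigma> by simp
  moreover have "avoids_pattern L [1, 3, 2]" "avoids_pattern r [1, 3, 2]"
  proof -
    have "\<forall>x\<in>set L. x < n" "\<forall>x\<in>set r. x < n" "\<forall>x\<in>set L. \<forall>y\<in>set r. y < x"
      using un lt by auto
    from contains_132_max[OF this] av
    show "avoids_pattern L [1, 3, 2]" "avoids_pattern r [1, 3, 2]" unfolding \<sigma> by simp_all
  qed
  ultimately have "l \<in> perms132" "r \<in> perms132"
    using dist set_r contains_pattern_map_add[of "length r" l]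
    unfolding perms132_iff L \<sigma> by simp_all
  moreover have "\<sigma> = glue l r" unfolding glue_def L \<sigma> n[symmetric] using n by (simp add: l_def)
  ultimately show ?thesis using that by blast
qed

lemma Nil_in_perms132 [simp]: "[] \<in> perms132"
  unfolding perms132_iff contains_132_iff by simp

lemma finite_perms132_length:
  assumes "S \<subseteq> perms132"
  shows "finite {\<sigma> \<in> S. length \<sigma> = n}"
proof (rule finite_subset)
  show "{\<sigma> \<in> S. length \<sigma> = n} \<subseteq> permutations_of_set {1..n}"
    using assms by (auto simp: perms132_def)
qed simp

section \<open>Generating functions\<close>

definition length_gf :: "nat list set \<Rightarrow> real fps" where
  "length_gf S = Abs_fps (\<lambda>n. of_nat (card {\<sigma> \<in> S. length \<sigma> = n}))"

lemma length_gf_empty [simp]: "length_gf {} = 0"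
  by (simp add: length_gf_def fps_eq_iff)

lemma length_gf_singleton_Nil: "length_gf {[]} = 1"
proof -
  have "{\<sigma> \<in> {[]}. length \<sigma> = n} = (if n = 0 then {[]} else {})" for n
    by auto
  then show ?thesis by (simp add: length_gf_def fps_eq_iff)
qed

lemma length_gf_Un:
  assumes "S \<subseteq> perms132" "T \<subseteq> perms132" "S \<inter> T = {}"
  shows "length_gf (S \<union> T) = length_gf S + length_gf T"
proof -
  have "{\<sigma> \<in> S \<union> T. length \<sigma> = n} = {\<sigma> \<in> S. length \<sigma> = n} \<union> {\<sigma> \<in> T. length \<sigma> = n}" for n
    by auto
  moreover have "{\<sigma> \<in> S. length \<sigma> = n} \<inter> {\<sigma> \<in> T. length \<sigma> = n} = {}" for n
    using assms(3) by auto
  ultimately show ?thesis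
    using assms(1,2)
    by (simp add: length_gf_def fps_eq_iff card_Un_disjoint finite_perms132_length)
qed

lemma length_gf_Diff:
  assumes "T \<subseteq> S" "S \<subseteq> perms132"
  shows "length_gf (S - T) = length_gf S - length_gf T"
proof -
  have "length_gf ((S - T) \<union> T) = length_gf (S - T) + length_gf T"
    using assms by (intro length_gf_Un) auto
  moreover have "(S - T) \<union> T = S" using assms(1) by auto
  ultimately show ?thesis by simp
qed

text \<open>Gluing is injective and adds one entry, so pairs are counted by the Cauchy product and
  the maximum contributes the factor \<open>fps_X\<close>.\<close>

lemma length_gf_glue:
  assumes "S \<subseteq> perms132" "T \<subseteq> perms132"
  shows "length_gf (case_prod glue ` (S \<times> T)) = fps_X * (length_gf S * length_gf T)"
proof (rule fps_ext)
  fix n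
  let ?S = "\<lambda>i. {\<sigma> \<in> S. length \<sigma> = i}" and ?T = "\<lambda>i. {\<sigma> \<in> T. length \<sigma> = i}"
  show "fps_nth (length_gf (case_prod glue ` (S \<times> T))) n =
        fps_nth (fps_X * (length_gf S * length_gf T)) n"
  proof (cases n)
    case 0
    have "{\<sigma> \<in> case_prod glue ` (S \<times> T). length \<sigma> = 0} = {}" by auto
    then show ?thesis unfolding length_gf_def 0 by simp
  next
    case (Suc m)
    \<comment> \<open>The glued words of length \<open>Suc m\<close> are sorted by the length
      \<open>i\<close> of the left factor.\<close>
    have eq: "{\<sigma> \<in> case_prod glue ` (S \<times> T). length \<sigma> = Suc m} =
          case_prod glue ` (\<Union>i\<in>{0..m}. ?S i \<times> ?T (m - i))"
      by fastforce
    have "inj_on (case_prod glue) (\<Union>i\<in>{0..m}. ?S i \<times> ?T (m - i))"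
      by (rule inj_on_subset[OF inj_on_glue]) (use assms in blast)
    then have "card {\<sigma> \<in> case_prod glue ` (S \<times> T). length \<sigma> = Suc m} =
          card (\<Union>i\<in>{0..m}. ?S i \<times> ?T (m - i))"
      unfolding eq by (rule card_image)
    also have "\<dots> = (\<Sum>i\<in>{0..m}. card (?S i \<times> ?T (m - i)))"
      using assms by (intro card_UN_disjoint) (auto simp: finite_perms132_length)
    finally have card_eq: "card {\<sigma> \<in> case_prod glue ` (S \<times> T). length \<sigma> = Suc m} =
          (\<Sum>i\<in>{0..m}. card (?S i) * card (?T (m - i)))"
      by (simp only: card_cartesian_product)
    have "fps_nth (fps_X * (length_gf S * length_gf T)) (Suc m) = fps_nth (length_gf S * length_gf T) m"
      by simp
    then show ?thesis
      unfolding Suc by (simp only: length_gf_def fps_nth_Abs_fps card_eq fps_mult_nth of_nat_sum of_nat_mult)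
  qed
qed

text \<open>The common shape of the three functional equations: up to three classes of left factors,
  each with its own class of right factors. Disjoint left classes suffice since gluing is injective;
  the empty permutation contributes the 1.\<close>

lemma length_gf_insert_glue:
  assumes "S\<^sub>1 \<union> S\<^sub>2 \<union> S\<^sub>3 \<subseteq> perms132" "T\<^sub>1 \<union> T\<^sub>2 \<union> T\<^sub>3 \<subseteq> perms132"
    and "S\<^sub>1 \<inter> S\<^sub>2 = {}" "S\<^sub>1 \<inter> S\<^sub>3 = {}" "S\<^sub>2 \<inter> S\<^sub>3 = {}"
  shows "length_gf ({[]} \<union> case_prod glue ` (S\<^sub>1 \<times> T\<^sub>1 \<union> S\<^sub>2 \<times> T\<^sub>2 \<union> S\<^sub>3 \<times> T\<^sub>3)) =
     1 + fps_X * (length_gf S\<^sub>1 * length_gf T\<^sub>1 + length_gf S\<^sub>2 * length_gf T\<^sub>2 +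
                  length_gf S\<^sub>3 * length_gf T\<^sub>3)"
proof -
  let ?g = "\<lambda>S T. case_prod glue ` (S \<times> T)"
  have sub: "?g S\<^sub>1 T\<^sub>1 \<subseteq> perms132" "?g S\<^sub>2 T\<^sub>2 \<subseteq> perms132" "?g S\<^sub>3 T\<^sub>3 \<subseteq> perms132"
    using assms(1,2) by (auto intro!: glue_in_perms132)
  have disj: "?g S T \<inter> ?g S' T' = {}"
    if "S \<subseteq> perms132" "T \<subseteq> perms132" "S' \<subseteq> perms132" "T' \<subseteq> perms132" "S \<inter> S' = {}" for S T S' T'
  proof -
    have "?g S T \<inter> ?g S' T' = case_prod glue ` (S \<times> T \<inter> S' \<times> T')"
      using that by (intro inj_on_image_Int[OF inj_on_glue, symmetric]) auto
    also have "S \<times> T \<inter> S' \<times> T' = {}" using that(5) by auto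
    finally show ?thesis by simp
  qed
  have "length_gf ({[]} \<union> (?g S\<^sub>1 T\<^sub>1 \<union> (?g S\<^sub>2 T\<^sub>2 \<union> ?g S\<^sub>3 T\<^sub>3))) =
      length_gf {[]} + (length_gf (?g S\<^sub>1 T\<^sub>1) + (length_gf (?g S\<^sub>2 T\<^sub>2) + length_gf (?g S\<^sub>3 T\<^sub>3)))"
  proof -
    have "?g S\<^sub>2 T\<^sub>2 \<inter> ?g S\<^sub>3 T\<^sub>3 = {}" "?g S\<^sub>1 T\<^sub>1 \<inter> (?g S\<^sub>2 T\<^sub>2 \<union> ?g S\<^sub>3 T\<^sub>3) = {}"
      unfolding Int_Un_distrib using assms disj by simp_all
    moreover have "{[]} \<inter> (?g S\<^sub>1 T\<^sub>1 \<union> (?g S\<^sub>2 T\<^sub>2 \<union> ?g S\<^sub>3 T\<^sub>3)) = {}"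
      by (auto simp: glue_def)
    ultimately show ?thesis
      using sub by (subst length_gf_Un; simp)+
  qed
  then show ?thesis
    using assms(1,2) by (simp add: image_Un Un_assoc length_gf_singleton_Nil length_gf_glue algebra_simps)
qed

section \<open>Functional equations for one, two and three blocks\<close>

definition avoiders :: "nat list \<Rightarrow> nat list set" where
  "avoiders bs = {\<sigma> \<in> perms132. \<not> has_blocks \<sigma> bs}"

lemma avoiders_subset: "avoiders bs \<subseteq> perms132"
  by (auto simp: avoiders_def)

lemma avoiders_mono: "avoiders bs \<subseteq> avoiders (bs @ cs)" "avoiders cs \<subseteq> avoiders (bs @ cs)"
  by (auto simp: avoiders_def dest: has_blocks_append_sub)

lemma avoiders_single_mono: "c \<le> b \<Longrightarrow> avoiders [c] \<subseteq> avoiders [b]"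
  by (auto simp: avoiders_def dest: has_blocks_single_mono)

text \<open>The maximum is grouped with the left factor because it, too, exceeds every entry of
  \<open>r\<close>.\<close>

lemma has_blocks_glue:
  assumes "l \<in> perms132" "r \<in> perms132"
  shows "has_blocks (glue l r) bs \<longleftrightarrow>
    (\<exists>cs ds. bs = cs @ ds \<and>
       has_blocks (map (\<lambda>x. x + length r) l @ [Suc (length l + length r)]) cs \<and> has_blocks r ds)"
proof -
  have "\<forall>x\<in>set (map (\<lambda>x. x + length r) l @ [Suc (length l + length r)]). \<forall>y\<in>set r. y < x"
    using glue_orders[OF assms] by auto
  from has_blocks_append[OF this] show ?thesis by (simp add: glue_def)
qed

lemma has_blocks_glue_single:
  assumes "l \<in> perms132" "r \<in> perms132" "a > 0"
  shows "has_blocks (glue l r) [a] \<longleftrightarrow> has_blocks r [a] \<or> has_blocks l [a - 1]"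
proof -
  have "(\<exists>cs ds. [a] = cs @ ds \<and> P cs \<and> Q ds) \<longleftrightarrow> P [] \<and> Q [a] \<or> P [a] \<and> Q []"
    for P Q :: "nat list \<Rightarrow> bool"
    by (auto simp: Cons_eq_append_conv)
  then show ?thesis
    unfolding has_blocks_glue[OF assms(1,2)]
    using assms(3) by (simp add: has_blocks_snoc_single[OF glue_orders(1)[OF assms(1,2)]] has_blocks_map_add)
qed

lemma has_blocks_glue_double:
  assumes "l \<in> perms132" "r \<in> perms132" "a > 0" "b > 0"
  shows "has_blocks (glue l r) [a, b] \<longleftrightarrow>
    has_blocks r [a, b] \<or> has_blocks l [a - 1] \<and> has_blocks r [b] \<or> has_blocks l [a, b]"
proof -
  note snoc = has_blocks_snoc_single[OF glue_orders(1)[OF assms(1,2)]]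
    has_blocks_snoc_multiple[OF glue_orders(1)[OF assms(1,2)]]
  have "(\<exists>cs ds. [a, b] = cs @ ds \<and> P cs \<and> Q ds) \<longleftrightarrow> P [] \<and> Q [a, b] \<or> P [a] \<and> Q [b] \<or> P [a, b] \<and> Q []"
    for P Q :: "nat list \<Rightarrow> bool"
    by (auto simp: Cons_eq_append_conv)
  then show ?thesis
    unfolding has_blocks_glue[OF assms(1,2)] using assms(3,4) by (simp add: snoc has_blocks_map_add)
qed

text \<open>The disjuncts are the cuts with 0, 1, 2 and 3 blocks on the left. Only the cut after the
  first block leaves a single block there, so only that block can use the maximum and is shortened
  to \<open>a - 1\<close>.\<close>

lemma has_blocks_glue_triple:
  assumes "l \<in> perms132" "r \<in> perms132" "a > 0" "b > 0" "c > 0"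
  shows "has_blocks (glue l r) [a, b, c] \<longleftrightarrow>
    has_blocks r [a, b, c] \<or> has_blocks l [a - 1] \<and> has_blocks r [b, c] \<or>
    has_blocks l [a, b] \<and> has_blocks r [c] \<or> has_blocks l [a, b, c]"
proof -
  note snoc = has_blocks_snoc_single[OF glue_orders(1)[OF assms(1,2)]]
    has_blocks_snoc_multiple[OF glue_orders(1)[OF assms(1,2)]]
  have "(\<exists>cs ds. [a, b, c] = cs @ ds \<and> P cs \<and> Q ds) \<longleftrightarrow>
      P [] \<and> Q [a, b, c] \<or> P [a] \<and> Q [b, c] \<or> P [a, b] \<and> Q [c] \<or> P [a, b, c] \<and> Q []"
    for P Q :: "nat list \<Rightarrow> bool"
    by (auto simp: Cons_eq_append_conv)
  then show ?thesis
    unfolding has_blocks_glue[OF assms(1,2)] using assms(3-5) by (simp add: snoc has_blocks_map_add)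
qed

text \<open>Translates a condition on glued words into one on pairs \<open>(l, r)\<close>; the empty
  permutation is listed apart as it has no maximum to cut at.\<close>

lemma avoiders_glue:
  assumes "\<not> has_blocks [] bs" "Q \<subseteq> perms132 \<times> perms132"
    and "\<And>l r. l \<in> perms132 \<Longrightarrow> r \<in> perms132 \<Longrightarrow> \<not> has_blocks (glue l r) bs \<longleftrightarrow> (l, r) \<in> Q"
  shows "avoiders bs = {[]} \<union> case_prod glue ` Q"
proof (intro equalityI subsetI)
  fix \<sigma> assume \<sigma>: "\<sigma> \<in> avoiders bs"
  show "\<sigma> \<in> {[]} \<union> case_prod glue ` Q"
  proof (cases "\<sigma> = []")
    case False
    from \<sigma> obtain l r where "l \<in> perms132" "r \<in> perms132" "\<sigma> = glue l r"
      using perms132_eq_glue[OF _ False] by (auto simp: avoiders_def)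
    with assms(3) \<sigma> show ?thesis by (auto simp: avoiders_def)
  qed simp
next
  fix \<sigma> assume "\<sigma> \<in> {[]} \<union> case_prod glue ` Q"
  with assms show "\<sigma> \<in> avoiders bs"
    by (fastforce simp: avoiders_def glue_in_perms132)
qed

lemma not_has_blocks_Nil_list: "b > 0 \<Longrightarrow> \<not> has_blocks [] (b # bs)"
  by (auto simp: has_blocks_def)

lemma length_gf_single:
  assumes "a > 0"
  shows "length_gf (avoiders [a]) = 1 + fps_X * (length_gf (avoiders [a - 1]) * length_gf (avoiders [a]))"
proof -
  have "avoiders [a] = {[]} \<union> case_prod glue `
      (avoiders [a - 1] \<times> avoiders [a] \<union> {} \<times> {} \<union> {} \<times> {})"
    using assms by (intro avoiders_glue)
      (auto simp: not_has_blocks_Nil_list has_blocks_glue_single avoiders_def)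
  from arg_cong[OF this, of length_gf] show ?thesis
    by (subst (asm) length_gf_insert_glue) (auto simp: avoiders_def)
qed

text \<open>The empty run occurs in every permutation; this starts the recursion for a single
  block.\<close>

lemma length_gf_avoiders_zero: "length_gf (avoiders [0]) = 0"
proof -
  have "avoiders [0] = {}" by (auto simp: avoiders_def has_blocks_single)
  then show ?thesis by simp
qed

text \<open>If \<open>l\<close> avoids the shortened first block, \<open>r\<close> only has to avoid
  both blocks; if \<open>l\<close> contains it but still avoids both blocks, \<open>r\<close> has to
  avoid the second one.\<close>

lemma length_gf_double:
  assumes "a > 0" "b > 0"
  shows "length_gf (avoiders [a, b]) = 1 + fps_X *
    (length_gf (avoiders [a - 1]) * length_gf (avoiders [a, b]) +
     (length_gf (avoiders [a, b]) - length_gf (avoiders [a - 1])) * length_gf (avoiders [b]))"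
proof -
  have sub: "avoiders [a - 1] \<subseteq> avoiders [a, b]" "avoiders [b] \<subseteq> avoiders [a, b]"
    using avoiders_mono(1)[of "[a]" "[b]"] avoiders_single_mono[of "a - 1" a]
      avoiders_mono(2)[of "[b]" "[a]"] by auto
  have "avoiders [a, b] = {[]} \<union> case_prod glue `
      (avoiders [a - 1] \<times> avoiders [a, b] \<union> (avoiders [a, b] - avoiders [a - 1]) \<times> avoiders [b] \<union> {} \<times> {})"
    using assms sub by (intro avoiders_glue)
      (auto simp: not_has_blocks_Nil_list has_blocks_glue_double avoiders_def)
  from arg_cong[OF this, of length_gf] show ?thesis
    using sub by (subst (asm) length_gf_insert_glue)
      (auto simp: length_gf_Diff avoiders_subset dest: subsetD[OF avoiders_subset])
qed

lemma length_gf_triple: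
  assumes "a > 0" "b > 0" "c > 0"
  shows "length_gf (avoiders [a, b, c]) = 1 + fps_X *
    (length_gf (avoiders [a - 1]) * length_gf (avoiders [a, b, c]) +
     (length_gf (avoiders [a, b]) - length_gf (avoiders [a - 1])) * length_gf (avoiders [b, c]) +
     (length_gf (avoiders [a, b, c]) - length_gf (avoiders [a, b])) * length_gf (avoiders [c]))"
proof -
  \<comment> \<open>The inclusions order the conditions on \<open>r\<close> by strength, so each
    class of \<open>l\<close> retains just one of them; they also turn differences of classes into
    differences of series.\<close>
  have sub: "avoiders [a - 1] \<subseteq> avoiders [a, b]" "avoiders [a, b] \<subseteq> avoiders [a, b, c]"
    "avoiders [b, c] \<subseteq> avoiders [a, b, c]" "avoiders [c] \<subseteq> avoiders [b, c]"
    using avoiders_mono(1)[of "[a]" "[b]"] avoiders_single_mono[of "a - 1" a]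
      avoiders_mono(1)[of "[a, b]" "[c]"] avoiders_mono(2)[of "[b, c]" "[a]"]
      avoiders_mono(2)[of "[c]" "[b]"]
    by auto
  have "avoiders [a, b, c] = {[]} \<union> case_prod glue `
      (avoiders [a - 1] \<times> avoiders [a, b, c] \<union> (avoiders [a, b] - avoiders [a - 1]) \<times> avoiders [b, c] \<union>
       (avoiders [a, b, c] - avoiders [a, b]) \<times> avoiders [c])"
    using assms sub by (intro avoiders_glue)
      (auto simp: not_has_blocks_Nil_list has_blocks_glue_triple avoiders_def)
  from arg_cong[OF this, of length_gf] show ?thesis
    using sub by (subst (asm) length_gf_insert_glue)
      (auto simp: length_gf_Diff avoiders_subset dest: subsetD[OF avoiders_subset])
qed

lemma avoid_gf_eq_length_gf:
  assumes "skew_blocks bs \<tau>"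
  shows "avoid_gf \<tau> = length_gf (avoiders bs)"
proof -
  have "{\<sigma> \<in> permutations_of_set {1..n}. avoids_pattern \<sigma> [1, 3, 2] \<and> avoids_pattern \<sigma> \<tau>} =
        {\<sigma> \<in> avoiders bs. length \<sigma> = n}" for n
    using length_finite_permutations_of_set[of _ "{1..n}"]
    by (auto simp: avoiders_def perms132_def contains_pattern_iff_has_blocks[OF assms])
  then show ?thesis by (simp add: avoid_gf_def avoid_count_def length_gf_def)
qed

section \<open>Chebyshev solution of the functional equations\<close>

lemma chebyshev_U_0: "chebyshev_U 0 = 1"
  by (rule chebyshev_U_unique) (simp add: chebyshev_U_cos)

text \<open>This is sin(u + \<theta>) + sin(u - \<theta>) = 2 cos \<theta> sin u, divided by sin
  \<theta>.\<close>

lemma chebyshev_U_rec: "chebyshev_U (p + 1) = pCons 0 (smult 2 (chebyshev_U p)) - chebyshev_U (p - 1)"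
proof (rule chebyshev_U_unique)
  fix \<theta> :: real assume s: "sin \<theta> \<noteq> 0"
  define u where "u = of_int (p + 1) * \<theta>"
  have "of_int (p + 1 + 1) * \<theta> = u + \<theta>" "of_int (p - 1 + 1) * \<theta> = u - \<theta>"
    by (simp_all add: u_def algebra_simps)
  with s show "poly (chebyshev_U (p + 1)) (cos \<theta>) =
      poly (pCons 0 (smult 2 (chebyshev_U p)) - chebyshev_U (p - 1)) (cos \<theta>)"
    by (simp only: chebyshev_U_cos[OF s] poly_diff poly_pCons poly_smult u_def[symmetric])
      (simp add: sin_add sin_diff field_simps)
qed

lemma chebyshev_U_fls_minus_one: "chebyshev_U_fls (-1) z = 0"
  by (simp add: chebyshev_U_fls_def chebyshev_U_minus_one)

lemma chebyshev_U_fls_0: "chebyshev_U_fls 0 z = 1"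
  by (simp add: chebyshev_U_fls_def chebyshev_U_0)

lemma chebyshev_U_fls_rec:
  "chebyshev_U_fls (p + 1) z = 2 * z * chebyshev_U_fls p z - chebyshev_U_fls (p - 1) z"
proof -
  have diff: "map_poly fls_const (q - r) = map_poly fls_const q - map_poly fls_const r" for q r :: "real poly"
    by (rule poly_eqI) (simp add: coeff_map_poly fls_minus_const)
  have two: "fls_const (2 :: real) = 2"
    using fls_const_numeral[of "num.Bit0 num.One"] by simp
  show ?thesis
    by (simp add: chebyshev_U_fls_def chebyshev_U_rec diff map_poly_pCons map_poly_smult two)
qed

text \<open>For fixed \<open>i\<close>, both sides satisfy the recurrence of \<open>V\<close> in
  \<open>j\<close> and in \<open>k\<close>, so agreement at the values 0 and 1 is enough.\<close>

lemma lucas_vajda_identity: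
  fixes V :: "nat \<Rightarrow> 'a :: comm_ring_1"
  assumes V0: "V 0 = 0" and V1: "V 1 = 1" and rec: "\<And>n. V (n + 2) = y * V (n + 1) - V n"
  shows "V (i + j) * V (i + k) - V i * V (i + j + k) = V j * V k"
proof -
  have step: "V (Suc (Suc n)) = y * V (Suc n) - V n" for n
    using rec[of n] by simp
  \<comment> \<open>The Cassini case \<open>j = k = 1\<close>; no alternating sign appears since the
    recurrence subtracts \<open>V n\<close>.\<close>
  have 11: "V (Suc i) * V (Suc i) - V i * V (Suc (Suc i)) = 1" for i
  proof (induction i)
    case (Suc i)
    then show ?case by (simp add: step algebra_simps)
  qed (use V0 V1 in simp)
  \<comment> \<open>The case \<open>k = 1\<close>, by the recurrence in \<open>j\<close>.\<close>
  have j1: "V (i + j) * V (Suc i) - V i * V (Suc (i + j)) = V j" for j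
  proof (induction j rule: induct_nat_012)
    case (ge2 n)
    have "V (i + Suc (Suc n)) * V (Suc i) - V i * V (Suc (i + Suc (Suc n))) =
        y * (V (i + Suc n) * V (Suc i) - V i * V (Suc (i + Suc n))) -
        (V (i + n) * V (Suc i) - V i * V (Suc (i + n)))"
      by (simp add: step algebra_simps)
    then show ?case by (simp only: ge2.IH step)
  qed (use V0 V1 11 in simp_all)
  show ?thesis
  proof (induction k rule: induct_nat_012)
    case (ge2 n)
    have "V (i + j) * V (i + Suc (Suc n)) - V i * V (i + j + Suc (Suc n)) =
        y * (V (i + j) * V (i + Suc n) - V i * V (i + j + Suc n)) -
        (V (i + j) * V (i + n) - V i * V (i + j + n))"
      by (simp add: step algebra_simps)
    then show ?case by (simp only: ge2.IH step) (simp add: algebra_simps)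
  qed (use V0 V1 j1 in simp_all)
qed

section \<open>Solving the functional equations in a field\<close>

text \<open>Here $V_n$ stands for $U_{n-1}(z)$ and $R_n$ for the generating function of the pattern
  $12\dots n$ at $x = t^2$.\<close>

context
  fixes V R :: "nat \<Rightarrow> 'a :: field" and t :: 'a
  assumes t: "t \<noteq> 0"
    and V0: "V 0 = 0" and V1: "V 1 = 1" and V_rec: "\<And>n. V (n + 2) = (1 / t) * V (n + 1) - V n"
    and R0: "R 0 = 0" and R_rec: "\<And>n. R (Suc n) = 1 + t\<^sup>2 * (R n * R (Suc n))"
begin

lemma t_V_rec: "t * V (Suc (Suc n)) = V (Suc n) - t * V n"
  using V_rec[of n] t by (simp add: field_simps)

lemmas V_product = lucas_vajda_identity[of V, OF V0 V1 V_rec]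

text \<open>The recurrence for $R$ also transports the non-vanishing of $V$, so no degree argument is needed.\<close>

lemma single_block_solution: "t * V (Suc n) * R n = V n \<and> V (Suc n) \<noteq> 0"
proof (induction n)
  case 0
  then show ?case using V0 V1 R0 by simp
next
  case (Suc n)
  \<comment> \<open>The induction hypothesis is read backwards: replacing \<open>V n\<close> by a
    multiple of \<open>V (Suc n)\<close> produces the bracket that the recurrence for
    \<open>R\<close> makes 1.\<close>
  have "t * V (Suc (Suc n)) * R (Suc n) = (V (Suc n) - t * (t * V (Suc n) * R n)) * R (Suc n)"
    using Suc by (simp add: t_V_rec)
  also have "\<dots> = V (Suc n) * (R (Suc n) - t\<^sup>2 * (R n * R (Suc n)))"
    by (simp add: algebra_simps power2_eq_square)
  also have "R (Suc n) - t\<^sup>2 * (R n * R (Suc n)) = 1"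
    using R_rec[of n] by (metis add_diff_cancel_right')
  finally show ?case using Suc by auto
qed

text \<open>The first factor is the coefficient of the unknown once the two-block or three-block
  equation is solved for it.\<close>

lemma two_factor:
  "(1 - t\<^sup>2 * R a - t\<^sup>2 * R b) * (V (Suc a) * V (Suc b)) = t * V (a + b + 2)"
proof -
  have R: "t * V (Suc a) * R a = V a" "t * V (Suc b) * R b = V b"
    using single_block_solution by blast+
  have "(1 - t\<^sup>2 * R a - t\<^sup>2 * R b) * (V (Suc a) * V (Suc b)) =
      (V (Suc a) - t * (t * V (Suc a) * R a)) * V (Suc b) - t * V (Suc a) * (t * V (Suc b) * R b)"
    by (simp add: algebra_simps power2_eq_square)
  also have "\<dots> = t * (V (Suc (Suc a)) * V (Suc b) - V (Suc a) * V b)"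
    by (simp only: R t_V_rec[symmetric]) (simp add: algebra_simps)
  \<comment> \<open>The addition formula, which is Vajda's identity with first index 1.\<close>
  also have "V (Suc (Suc a)) * V (Suc b) - V (Suc a) * V b = V (a + b + 2)"
    using V_product[of 1 "Suc a" b] V1 by (simp add: algebra_simps)
  finally show ?thesis .
qed

text \<open>The blocks have lengths \<open>a + 1\<close> and \<open>b\<close>, since
  \<open>R a\<close> belongs to the shortened first block. The result agrees with
  \<open>single_block_solution\<close> for one block of the total length
  \<open>a + b + 1\<close>.\<close>

lemma two_block_solution:
  assumes F: "F = 1 + t\<^sup>2 * (R a * F + (F - R a) * R b)"
  shows "t * V (a + b + 2) * F = V (a + b + 1)"
proof -
  have R: "t * V (Suc a) * R a = V a" "t * V (Suc b) * R b = V b"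
    using single_block_solution by blast+
  from F have "F * (1 - t\<^sup>2 * R a - t\<^sup>2 * R b) = 1 - t\<^sup>2 * R a * R b"
    by (simp add: algebra_simps)
  then have "F * ((1 - t\<^sup>2 * R a - t\<^sup>2 * R b) * (V (Suc a) * V (Suc b))) =
      (1 - t\<^sup>2 * R a * R b) * (V (Suc a) * V (Suc b))"
    by (simp only: mult.assoc[symmetric])
  also have "\<dots> = V (Suc a) * V (Suc b) - (t * V (Suc a) * R a) * (t * V (Suc b) * R b)"
    by (simp add: algebra_simps power2_eq_square)
  also have "\<dots> = V (a + b + 1)"
    unfolding R using V_product[of 1 a b] V1 by (simp add: algebra_simps)
  finally show ?thesis unfolding two_factor by (simp add: mult_ac)
qed

text \<open>The blocks have lengths \<open>a + 1\<close>, \<open>b + 1\<close> and \<open>c\<close>.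
  Clearing all denominators and applying Vajda's identity repeatedly removes every index except
  those of the claim.\<close>

lemma three_block_solution:
  assumes Fab: "F\<^sub>a\<^sub>b = 1 + t\<^sup>2 * (R a * F\<^sub>a\<^sub>b + (F\<^sub>a\<^sub>b - R a) * R (Suc b))"
    and Fbc: "F\<^sub>b\<^sub>c = 1 + t\<^sup>2 * (R b * F\<^sub>b\<^sub>c + (F\<^sub>b\<^sub>c - R b) * R c)"
    and F: "F = 1 + t\<^sup>2 * (R a * F + (F\<^sub>a\<^sub>b - R a) * F\<^sub>b\<^sub>c + (F - F\<^sub>a\<^sub>b) * R c)"
  shows "F * (t * V (a + b + 3) * V (a + c + 2) * V (b + c + 2)) =
    V (a + b + 3) * V (a + c + 1) * V (b + c + 2) + V (b + 1) * V (b + 2)"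
proof -
  \<comment> \<open>Up to factors \<open>t\<close>, \<open>A\<close> and \<open>C\<close> are the
    denominators of \<open>R a\<close> and \<open>R c\<close>; the pairs \<open>Nab\<close>,
    \<open>Dab\<close> and \<open>Nbc\<close>, \<open>Dbc\<close> are numerators and denominators of
    the two-block series.\<close>
  define A C Dab Dbc Nab Nbc where defs: "A = V (a + 1)" "C = V (c + 1)" "Dab = V (a + b + 3)"
    "Dbc = V (b + c + 2)" "Nab = V (a + b + 2)" "Nbc = V (b + c + 1)"
  have R: "t * A * R a = V a" "t * C * R c = V c"
    using single_block_solution by (simp_all add: defs)
  have N: "t * Dab * F\<^sub>a\<^sub>b = Nab" "t * Dbc * F\<^sub>b\<^sub>c = Nbc"
    using two_block_solution[OF Fab] two_block_solution[OF Fbc] by (simp_all add: defs numeral_eq_Suc)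
  from F have "F * (1 - t\<^sup>2 * R a - t\<^sup>2 * R c) =
      1 + t\<^sup>2 * (F\<^sub>a\<^sub>b * F\<^sub>b\<^sub>c - R a * F\<^sub>b\<^sub>c - F\<^sub>a\<^sub>b * R c)"
    by (simp add: algebra_simps)
  then have "F * (1 - t\<^sup>2 * R a - t\<^sup>2 * R c) * (A * C * Dab * Dbc) =
      (1 + t\<^sup>2 * (F\<^sub>a\<^sub>b * F\<^sub>b\<^sub>c - R a * F\<^sub>b\<^sub>c - F\<^sub>a\<^sub>b * R c)) * (A * C * Dab * Dbc)"
    by (rule arg_cong)
  also have "\<dots> = A * C * Dab * Dbc + (t * Dab * F\<^sub>a\<^sub>b) * (t * Dbc * F\<^sub>b\<^sub>c) * A * C
      - (t * A * R a) * (t * Dbc * F\<^sub>b\<^sub>c) * C * Dab - (t * Dab * F\<^sub>a\<^sub>b) * (t * C * R c) * A * Dbc"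
    by (simp add: algebra_simps power2_eq_square)
  also have "\<dots> = A * C * Dab * Dbc + Nab * Nbc * A * C - V a * Nbc * C * Dab - Nab * V c * A * Dbc"
    unfolding R N ..
  \<comment> \<open>Grouped so that both brackets and the product \<open>Nbc * C\<close> are
    accessible to Vajda's identity.\<close>
  also have "\<dots> = Dbc * A * (Dab * C - Nab * V c) + (Nab * A - V a * Dab) * (Nbc * C)"
    by (simp add: algebra_simps)
  also have "Dab * C - Nab * V c = V (a + b + c + 3)"
    using V_product[of 1 "a + b + 2" c] V1 by (simp add: defs algebra_simps numeral_eq_Suc)
  also have "Nab * A - V a * Dab = V (b + 2)"
    using V_product[of a "1" "b + 2"] V1 by (simp add: defs algebra_simps numeral_eq_Suc)
  also have "Nbc * C = V (b + 1) + V c * Dbc"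
    using V_product[of c 1 "b + 1"] V1 by (simp add: defs algebra_simps numeral_eq_Suc)
  \<comment> \<open>The second summand with \<open>Dbc\<close> joins the first, so that one more
    instance factors out \<open>Dab\<close>.\<close>
  also have "Dbc * A * V (a + b + c + 3) + V (b + 2) * (V (b + 1) + V c * Dbc) =
      Dbc * (A * V (a + b + c + 3) + V (b + 2) * V c) + V (b + 1) * V (b + 2)"
    by (simp add: algebra_simps)
  also have "A * V (a + b + c + 3) + V (b + 2) * V c = Dab * V (a + c + 1)"
    using V_product[of "a + 1" "b + 2" c] by (simp add: defs algebra_simps numeral_eq_Suc)
  finally have "F * ((1 - t\<^sup>2 * R a - t\<^sup>2 * R c) * (V (Suc a) * V (Suc c))) * (Dab * Dbc) =
      Dbc * (Dab * V (a + c + 1)) + V (b + 1) * V (b + 2)"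
    by (simp add: defs mult_ac)
  \<comment> \<open>The auxiliary product \<open>A * C\<close> is absorbed by
    \<open>two_factor\<close>, so nothing has to be cancelled.\<close>
  then show ?thesis unfolding two_factor by (simp add: defs mult_ac)
qed

end

section \<open>Passing to Laurent series in the square root of x\<close>

definition sqrt_subst :: "real fps \<Rightarrow> real fls" where
  "sqrt_subst f = fps_to_fls (f oo fps_X ^ 2)"

text \<open>Substituting the square of the variable is a ring homomorphism, so it carries each
  functional equation over to the field in which 1/(2t) exists.\<close>

lemma sqrt_subst_hom:
  "sqrt_subst 0 = 0" "sqrt_subst 1 = 1" "sqrt_subst fps_X = fls_X\<^sup>2"
  "sqrt_subst (f + g) = sqrt_subst f + sqrt_subst g"
  "sqrt_subst (f - g) = sqrt_subst f - sqrt_subst g"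
  "sqrt_subst (f * g) = sqrt_subst f * sqrt_subst g"
  by (simp_all add: sqrt_subst_def fps_compose_add_distrib fps_compose_sub_distrib
      fps_compose_mult_distrib fls_times_fps_to_fls fps_to_fls_power)

(* Identity of formal Laurent series in t = sqrt x; thus x = t^2 and z = 1 / (2 t). *)
theorem theorem2p5:
  fixes k m\<^sub>1 m\<^sub>2 :: nat
  assumes "k > m\<^sub>1" and "m\<^sub>1 > m\<^sub>2" and "m\<^sub>2 > 0"
  shows
    "let \<alpha> = int k - int m\<^sub>1; \<beta> = int m\<^sub>1 - int m\<^sub>2; \<gamma> = int m\<^sub>2;
         t = (fls_X :: real fls);
         z = 1 / (2 * t);
         U = (\<lambda>p. chebyshev_U_fls p z)
     in fps_to_fls (avoid_gf (three_block_pattern k m\<^sub>1 m\<^sub>2) oo fps_X ^ 2) =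
          (U (\<alpha> + \<beta>) * U (\<alpha> + \<gamma> - 1) * U (\<beta> + \<gamma>) + U (\<beta> - 1) * U \<beta>) /
          (t * U (\<alpha> + \<beta>) * U (\<alpha> + \<gamma>) * U (\<beta> + \<gamma>))"
proof -
  \<comment> \<open>Here \<alpha> = \<open>a + 1\<close>, \<beta> = \<open>b + 1\<close> and
    \<gamma> = \<open>c\<close>: the first block of each equation is written as a successor, because
    its shortened version occurs there.\<close>
  define a b c where "a = k - m\<^sub>1 - 1" and "b = m\<^sub>1 - m\<^sub>2 - 1" and "c = m\<^sub>2"
  have sizes: "k - m\<^sub>1 = Suc a" "m\<^sub>1 - m\<^sub>2 = Suc b" "m\<^sub>2 = c" "c > 0"
    using assms by (simp_all add: a_def b_def c_def)
  have ints: "int k - int m\<^sub>1 = int a + 1" "int m\<^sub>1 - int m\<^sub>2 = int b + 1"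
    using assms by (simp_all add: a_def b_def)
  define t :: "real fls" where "t = fls_X"
  \<comment> \<open>The index shift makes the sequence start with U_{-1} = 0 and U_0 = 1.\<close>
  define V where "V n = chebyshev_U_fls (int n - 1) (1 / (2 * t))" for n
  define R where "R n = sqrt_subst (length_gf (avoiders [n]))" for n
  define F\<^sub>a\<^sub>b where "F\<^sub>a\<^sub>b = sqrt_subst (length_gf (avoiders [Suc a, Suc b]))"
  define F\<^sub>b\<^sub>c where "F\<^sub>b\<^sub>c = sqrt_subst (length_gf (avoiders [Suc b, c]))"
  define F where "F = sqrt_subst (length_gf (avoiders [Suc a, Suc b, c]))"
  have t: "t \<noteq> 0" by (simp add: t_def)
  have V0: "V 0 = 0" by (simp add: V_def chebyshev_U_fls_minus_one)
  have V1: "V 1 = 1" by (simp add: V_def chebyshev_U_fls_0)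
  have V_rec: "V (n + 2) = (1 / t) * V (n + 1) - V n" for n
    using chebyshev_U_fls_rec[of "int n" "1 / (2 * t)"] by (simp add: V_def add.commute)
  have R0: "R 0 = 0" by (simp add: R_def length_gf_avoiders_zero sqrt_subst_hom)
  have R_rec: "R (Suc n) = 1 + t\<^sup>2 * (R n * R (Suc n))" for n
    using arg_cong[OF length_gf_single[of "Suc n"], of sqrt_subst]
    by (simp add: R_def t_def sqrt_subst_hom)
  note V_R = t V0 V1 V_rec R0 R_rec
  have "F\<^sub>a\<^sub>b = 1 + t\<^sup>2 * (R a * F\<^sub>a\<^sub>b + (F\<^sub>a\<^sub>b - R a) * R (Suc b))"
    using arg_cong[OF length_gf_double[of "Suc a" "Suc b"], of sqrt_subst]
    by (simp add: R_def F\<^sub>a\<^sub>b_def t_def sqrt_subst_hom)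
  moreover have "F\<^sub>b\<^sub>c = 1 + t\<^sup>2 * (R b * F\<^sub>b\<^sub>c + (F\<^sub>b\<^sub>c - R b) * R c)"
    using arg_cong[OF length_gf_double[of "Suc b" c], of sqrt_subst] sizes(4)
    by (simp add: R_def F\<^sub>b\<^sub>c_def t_def sqrt_subst_hom)
  moreover have "F = 1 + t\<^sup>2 * (R a * F + (F\<^sub>a\<^sub>b - R a) * F\<^sub>b\<^sub>c + (F - F\<^sub>a\<^sub>b) * R c)"
    using arg_cong[OF length_gf_triple[of "Suc a" "Suc b" c], of sqrt_subst] sizes(4)
    by (simp add: R_def F_def F\<^sub>a\<^sub>b_def F\<^sub>b\<^sub>c_def t_def sqrt_subst_hom)
  ultimately have "F * (t * V (a + b + 3) * V (a + c + 2) * V (b + c + 2)) =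
      V (a + b + 3) * V (a + c + 1) * V (b + c + 2) + V (b + 1) * V (b + 2)"
    by (rule three_block_solution[OF V_R])
  \<comment> \<open>\<open>single_block_solution\<close> also provides non-vanishing at every
    positive index, which permits division by the three Chebyshev factors.\<close>
  moreover have "V (Suc n) \<noteq> 0" for n
    using single_block_solution[OF V_R] by blast
  from this[of "a + b + 2"] this[of "a + c + 1"] this[of "b + c + 1"]
  have "t * V (a + b + 3) * V (a + c + 2) * V (b + c + 2) \<noteq> 0"
    using t by (simp add: numeral_eq_Suc)
  ultimately have "F = (V (a + b + 3) * V (a + c + 1) * V (b + c + 2) + V (b + 1) * V (b + 2)) /
      (t * V (a + b + 3) * V (a + c + 2) * V (b + c + 2))"
    by (simp only: eq_divide_eq) simp
  moreover have "fps_to_fls (avoid_gf (three_block_pattern k m\<^sub>1 m\<^sub>2) oo fps_X ^ 2) = F"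
    using avoid_gf_eq_length_gf[OF skew_blocks_three_block_pattern[OF assms(1,2), unfolded sizes(1,2)]]
    by (simp add: F_def sqrt_subst_def c_def)
  \<comment> \<open>Undoing the shift, \<open>V (a + b + 3)\<close> has Chebyshev index \<alpha> +
    \<beta>, \<open>V (a + c + 1)\<close> has \<alpha> + \<gamma> - 1, and \<open>V (b + 1)\<close>
    has \<beta> - 1.\<close>
  ultimately show ?thesis
    unfolding Let_def ints unfolding sizes(3) by (simp add: V_def t_def algebra_simps)
qed

end
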